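(* Let $A_1,\dots,A_d$ be Hermitian $n\times n$ matrices and let $Q\subset\mathbb{C}^N=\mathbb{C}^n_z\times\mathbb{C}^d_w$ be the quadric submanifold $Q=\{\rho_1=\dots=\rho_d=0\}$, where $\rho_j(z,w)=\mathrm{Re}\, w_j-{}^t\bar z A_j z$. Let $V\in\mathbb{C}^n$. A stationary disc for $Q$ of the form $$f(\zeta)=\left((1-\zeta)V,\;2(1-\zeta)\,{}^t\overline{V}A_1V,\;\ldots,\;2(1-\zeta)\,{}^t\overline{V}A_dV\right)$$ is nondefective if and only if $A_1V,\ldots,A_dV$ are $\mathbb{R}$-linearly independent.
   Context: $\Delta$ is the open unit disc in $\mathbb{C}$. A disc $f:\overline\Delta\to\mathbb{C}^N$, continuous on $\overline\Delta$ and holomorphic on $\Delta$, is attached to $Q$ if $f(\partial\Delta)\subset Q$. It is stationary for $Q$ if it is attached to $Q$ and has a lift $\boldsymbol{f}=(f,\tilde f)$ to $T^*\mathbb{C}^N\cong\mathbb{C}^{2N}$, holomorphic on $\Delta$ and continuous on $\overline\Delta$, such that for every $\zeta\in\partial\Delta$, $\tilde f(\zeta)\in \zeta N^*_{f(\zeta)}Q\setminus\{0\}$, where $N^*_{q}Q=\mathrm{span}_{\mathbb{R}}\{\partial\rho_1(q),\dots,\partial\rho_d(q)\}$ is the conormal fiber. A stationary disc $f$ is defective if it admits such a lift $\boldsymbol f=(f,\tilde f)$ for which $(f,\tilde f/\zeta)$ is holomorphic on $\Delta$. For the quadric $Q$ this means: $f$ is defective if there exists $c=(c_1,\ldots,c_d)\in\mathbb{R}^d\setminus\{0\}$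 such that the map $\zeta\mapsto\sum_{j=1}^d c_j\,\partial_z\rho_j(f(\zeta))$, defined on $\partial\Delta$, extends holomorphically to $\Delta$ (here $\partial_z\rho_j=-{}^t\bar zA_j$ is the row vector of derivatives with respect to $z$). A stationary disc is nondefective if it is not defective. *)

theory Defs
  imports "HOL-Analysis.Analysis"
begin

text \<open>
  A submanifold \<open>Q = {q. \<forall>j. \<rho> j q = 0}\<close> of \<open>\<complex>\<^sup>N\<close> is given by a finite family \<open>\<rho>\<close> of real
  defining functions. The covector \<open>\<Sum>\<^sub>k p\<^sub>k dZ\<^sub>k\<close> is identified with \<open>p\<close>, so that
  \<open>T\<^sup>*\<complex>\<^sup>N\<close> is \<open>\<complex>\<^sup>N \<times> \<complex>\<^sup>N\<close>.
\<close>

definition holomorphic_vec_on :: "(complex \<Rightarrow> complex ^ 'N) \<Rightarrow> complex set \<Rightarrow> bool" where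
  "holomorphic_vec_on f S \<longleftrightarrow> (\<forall>k. (\<lambda>\<zeta>. f \<zeta> $ k) holomorphic_on S)"

definition holo_disc :: "(complex \<Rightarrow> complex ^ 'N) \<Rightarrow> bool" where
  "holo_disc f \<longleftrightarrow> continuous_on (cball 0 1) f \<and> holomorphic_vec_on f (ball 0 1)"

definition zero_locus :: "('d::finite \<Rightarrow> complex ^ 'N \<Rightarrow> real) \<Rightarrow> (complex ^ 'N) set" where
  "zero_locus \<rho> = {q. \<forall>j. \<rho> j q = 0}"

definition attached_disc ::
  "('d::finite \<Rightarrow> complex ^ 'N \<Rightarrow> real) \<Rightarrow> (complex \<Rightarrow> complex ^ 'N) \<Rightarrow> bool" where
  "attached_disc \<rho> f \<longleftrightarrow> holo_disc f \<and> f ` sphere 0 1 \<subseteq> zero_locus \<rho>"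

text \<open>
  The (1,0)-differential \<open>(\<partial>r/\<partial>Z\<^sub>k)\<^sub>k\<close>, where
  \<open>\<partial>/\<partial>Z\<^sub>k = 1/2 (\<partial>/\<partial>x\<^sub>k - \<i> \<partial>/\<partial>y\<^sub>k)\<close>; the directions of \<open>x\<^sub>k\<close> and \<open>y\<^sub>k\<close> are
  \<open>axis k 1\<close> and \<open>axis k \<i>\<close>.
\<close>

definition del :: "(complex ^ 'N \<Rightarrow> real) \<Rightarrow> complex ^ 'N \<Rightarrow> complex ^ 'N" where
  "del r q = (\<chi> k. (complex_of_real (frechet_derivative r (at q) (axis k 1))
                  - \<i> * complex_of_real (frechet_derivative r (at q) (axis k \<i>))) / 2)"

text \<open>\<^const>\<open>span\<close> is the span over the reals.\<close>

definition conormal_fiber ::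
  "('d::finite \<Rightarrow> complex ^ 'N \<Rightarrow> real) \<Rightarrow> complex ^ 'N \<Rightarrow> (complex ^ 'N) set" where
  "conormal_fiber \<rho> q = span (range (\<lambda>j. del (\<rho> j) q))"

definition stationary_lift ::
  "('d::finite \<Rightarrow> complex ^ 'N \<Rightarrow> real) \<Rightarrow> (complex \<Rightarrow> complex ^ 'N) \<Rightarrow> (complex \<Rightarrow> complex ^ 'N) \<Rightarrow> bool"
where
  "stationary_lift \<rho> f g \<longleftrightarrow> holo_disc g \<and>
     (\<forall>\<zeta>\<in>sphere 0 1. g \<zeta> \<in> (\<lambda>p. \<zeta> *s p) ` conormal_fiber \<rho> (f \<zeta>) - {0})"

definition stationary_disc ::
  "('d::finite \<Rightarrow> complex ^ 'N \<Rightarrow> real) \<Rightarrow> (complex \<Rightarrow> complex ^ 'N) \<Rightarrow> bool" where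
  "stationary_disc \<rho> f \<longleftrightarrow> attached_disc \<rho> f \<and> (\<exists>g. stationary_lift \<rho> f g)"

text \<open>
  Since division by \<open>0\<close> yields \<open>0\<close>, holomorphy of \<open>g \<zeta> / \<zeta>\<close> on the whole disc is expressed
  through a holomorphic \<open>h\<close> that agrees with the quotient off the origin.
\<close>

definition defective_disc ::
  "('d::finite \<Rightarrow> complex ^ 'N \<Rightarrow> real) \<Rightarrow> (complex \<Rightarrow> complex ^ 'N) \<Rightarrow> bool" where
  "defective_disc \<rho> f \<longleftrightarrow> stationary_disc \<rho> f \<and>
     (\<exists>g. stationary_lift \<rho> f g \<and>
        (\<exists>h. holomorphic_vec_on h (ball 0 1) \<and>
             (\<forall>\<zeta>\<in>ball 0 1 - {0}. h \<zeta> = (1 / \<zeta>) *s g \<zeta>)))"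

definition nondefective_disc ::
  "('d::finite \<Rightarrow> complex ^ 'N \<Rightarrow> real) \<Rightarrow> (complex \<Rightarrow> complex ^ 'N) \<Rightarrow> bool" where
  "nondefective_disc \<rho> f \<longleftrightarrow> stationary_disc \<rho> f \<and> \<not> defective_disc \<rho> f"

definition hermitian_matrix :: "complex ^ 'n ^ 'n \<Rightarrow> bool" where
  "hermitian_matrix A \<longleftrightarrow> transpose (map_matrix cnj A) = A"

definition herm_form :: "complex ^ 'n ^ 'n \<Rightarrow> complex ^ 'n \<Rightarrow> complex" where
  "herm_form A z = (\<Sum>i\<in>UNIV. cnj (z $ i) * (A *v z) $ i)"

text \<open>
  \<open>\<complex>\<^sup>n \<times> \<complex>\<^sup>d\<close> is \<^typ>\<open>complex ^ ('n + 'd)\<close>, with \<open>z\<close> the \<^const>\<open>Inl\<close> and \<open>w\<close> the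
  \<^const>\<open>Inr\<close> coordinates.
\<close>

definition join_zw :: "complex ^ 'n::finite \<Rightarrow> complex ^ 'd::finite \<Rightarrow> complex ^ ('n + 'd)" where
  "join_zw z w = (\<chi> k. case k of Inl i \<Rightarrow> z $ i | Inr j \<Rightarrow> w $ j)"

definition z_part :: "complex ^ ('n::finite + 'd::finite) \<Rightarrow> complex ^ 'n" where
  "z_part q = (\<chi> i. q $ Inl i)"

definition w_part :: "complex ^ ('n::finite + 'd::finite) \<Rightarrow> complex ^ 'd" where
  "w_part q = (\<chi> j. q $ Inr j)"

text \<open>
  For Hermitian \<open>A j\<close> the value of \<^const>\<open>herm_form\<close> is real, so \<^const>\<open>Re\<close> only changes
  its type.
\<close>

definition quadric_rho ::
  "('d::finite \<Rightarrow> complex ^ 'n::finite ^ 'n) \<Rightarrow> 'd \<Rightarrow> complex ^ ('n + 'd) \<Rightarrow> real" where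
  "quadric_rho A j q = Re (w_part q $ j) - Re (herm_form (A j) (z_part q))"

end

theory Submission
  imports Defs "HOL-Complex_Analysis.Conformal_Mappings"
begin

text \<open>
  The conormal covectors of the quadric at \<open>(z, w)\<close> are
  \<open>(- \<^sup>t(cnj z) \<Sum>\<^sub>j c\<^sub>j A\<^sub>j, c/2)\<close> with \<open>c\<close> real: their \<open>w\<close>-part reads off the coefficients.
  Let \<open>g\<close> be a lift of the given disc with \<open>g \<zeta> / \<zeta>\<close> holomorphic, and write \<open>g \<zeta> / \<zeta>\<close> on the
  unit circle as the covector with coefficients \<open>c\<^sub>j(\<zeta>)\<close>. The \<open>w\<close>-part of \<open>g \<zeta> / \<zeta>\<close> is
  holomorphic and has the real boundary values \<open>c\<^sub>j(\<zeta>)/2\<close>, so it is constant; hence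
  \<open>c\<close> does not depend on \<open>\<zeta>\<close> (lemma \<open>real_boundary_quotient\<close>). The \<open>z\<close>-part of \<open>g \<zeta>\<close> then has the boundary
  values \<open>(1 - \<zeta>) a\<close>, where \<open>a\<close> is the conjugate of \<open>\<Sum>\<^sub>j c\<^sub>j A\<^sub>j V\<close>, because
  \<open>\<zeta> (1 - cnj \<zeta>) = \<zeta> - 1\<close> on the circle. So it is \<open>(1 - \<zeta>) a\<close> throughout the disc, and since it
  must vanish at \<open>0\<close>, the vector \<open>a\<close> is \<open>0\<close>. As a lift has no zeros on the circle,
  \<open>c \<noteq> 0\<close>, so the vectors \<open>A\<^sub>j V\<close> are linearly dependent over the reals.

  Conversely, a nontrivial relation \<open>\<Sum>\<^sub>j c\<^sub>j A\<^sub>j V = 0\<close> makes the covector with constant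
  coefficients \<open>c\<close> equal to \<open>(0, c/2)\<close> along the whole disc, and \<open>\<zeta> \<mapsto> \<zeta> (0, c/2)\<close> is
  the lift that shows that the disc is defective.
\<close>

section \<open>Real linear combinations of finite families\<close>

lemma span_range_iff:
  fixes v :: "'d::finite \<Rightarrow> 'a::real_vector"
  shows "x \<in> span (range v) \<longleftrightarrow> (\<exists>c. x = (\<Sum>j\<in>UNIV. c j *\<^sub>R v j))"
proof
  let ?L = "{x. \<exists>c. x = (\<Sum>j\<in>UNIV. c j *\<^sub>R v j)}"
  assume x: "x \<in> span (range v)"
  have "v i \<in> ?L" for i
    by (auto intro!: exI[of _ "\<lambda>j. if j = i then 1 else 0"] simp: if_distrib[of "\<lambda>x. x *\<^sub>R _"] cong: if_cong)
  moreover have "subspace ?L"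
  proof (rule subspaceI)
    show "0 \<in> ?L" by (auto intro!: exI[of _ "\<lambda>_. 0"])
  next
    fix x y assume "x \<in> ?L" "y \<in> ?L"
    then obtain c e where "x = (\<Sum>j\<in>UNIV. c j *\<^sub>R v j)" "y = (\<Sum>j\<in>UNIV. e j *\<^sub>R v j)" by auto
    then show "x + y \<in> ?L"
      by (auto intro!: exI[of _ "\<lambda>j. c j + e j"] simp: scaleR_left_distrib sum.distrib)
  next
    fix r x assume "x \<in> ?L"
    then obtain c where "x = (\<Sum>j\<in>UNIV. c j *\<^sub>R v j)" by auto
    then show "r *\<^sub>R x \<in> ?L"
      by (auto intro!: exI[of _ "\<lambda>j. r * c j"] simp: scaleR_sum_right)
  qed
  ultimately have "span (range v) \<subseteq> ?L" by (intro span_minimal) auto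
  with x show "\<exists>c. x = (\<Sum>j\<in>UNIV. c j *\<^sub>R v j)" by auto
next
  assume "\<exists>c. x = (\<Sum>j\<in>UNIV. c j *\<^sub>R v j)"
  then show "x \<in> span (range v)" by (elim exE, hypsubst) (intro span_sum span_scale span_base rangeI)
qed

lemma independent_family_iff:
  fixes v :: "'d::finite \<Rightarrow> 'a::real_vector"
  shows "inj v \<and> independent (range v) \<longleftrightarrow>
         (\<forall>c. (\<Sum>j\<in>UNIV. c j *\<^sub>R v j) = 0 \<longrightarrow> (\<forall>j. c j = 0))" (is "?L \<longleftrightarrow> ?R")
proof
  assume ?L
  then have inj: "inj v" and ind: "independent (range v)" by auto
  have indep: "u x = 0" if "(\<Sum>x\<in>range v. u x *\<^sub>R x) = 0" "x \<in> range v" for u x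
    using ind that by (auto simp: dependent_finite)
  show ?R
  proof (intro allI impI)
    fix c j assume "(\<Sum>j\<in>UNIV. c j *\<^sub>R v j) = 0"
    then have "(\<Sum>x\<in>range v. c (inv v x) *\<^sub>R x) = 0"
      by (simp add: sum.reindex[OF inj] inv_f_f[OF inj])
    from indep[OF this, of "v j"] show "c j = 0" by (simp add: inv_f_f[OF inj])
  qed
next
  assume R: ?R
  have inj: "inj v"
  proof (rule injI, rule ccontr)
    fix i j assume eq: "v i = v j" and "i \<noteq> j"
    let ?c = "\<lambda>k. (if k = i then 1 else 0) - (if k = j then 1 else 0) :: real"
    have "(\<Sum>k\<in>UNIV. ?c k *\<^sub>R v k) = v i - v j"
      by (simp add: scaleR_left_diff_distrib sum_subtractf if_distrib[of "\<lambda>x. x *\<^sub>R _"] cong: if_cong)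
    with eq have "(\<Sum>k\<in>UNIV. ?c k *\<^sub>R v k) = 0" by simp
    with \<open>i \<noteq> j\<close> R[rule_format, of ?c i] show False by simp
  qed
  moreover have "independent (range v)"
  proof
    assume "dependent (range v)"
    then obtain u j where u: "u (v j) \<noteq> 0" "(\<Sum>x\<in>range v. u x *\<^sub>R x) = 0"
      by (auto simp: dependent_finite)
    then have "(\<Sum>j\<in>UNIV. u (v j) *\<^sub>R v j) = 0" by (simp add: sum.reindex[OF inj])
    with R have "u (v j) = 0" by (auto dest: spec[of _ "\<lambda>j. u (v j)"])
    with u show False by simp
  qed
  ultimately show ?L by simp
qed

section \<open>Holomorphic functions with real boundary values\<close>

text \<open>
  By the maximum principle for \<open>\<plusminus> Im F\<close> the function is real on the whole disc; a nonconstant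
  holomorphic function is open, so its values cannot all be real.
\<close>

lemma real_boundary_values_imp_constant:
  assumes cont: "continuous_on (cball 0 1) F" and hol: "F holomorphic_on ball 0 1"
    and real: "\<And>\<zeta>. \<zeta> \<in> sphere 0 1 \<Longrightarrow> F \<zeta> \<in> \<real>"
  obtains r :: real where "\<And>\<zeta>. \<zeta> \<in> cball 0 1 \<Longrightarrow> F \<zeta> = of_real r"
proof -
  have Im_0: "Im (F z) = 0" if z: "z \<in> cball 0 1" for z
  proof -
    have "Re (\<i> * F z) \<le> 0"
      by (rule maximum_real_frontier[of "\<lambda>z. \<i> * F z" "cball 0 1"])
        (use z cont hol real in \<open>auto intro!: holomorphic_intros continuous_intros simp: complex_is_Real_iff\<close>)
    moreover have "Re (- \<i> * F z) \<le> 0"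
      by (rule maximum_real_frontier[of "\<lambda>z. - \<i> * F z" "cball 0 1"])
        (use z cont hol real in \<open>auto intro!: holomorphic_intros continuous_intros simp: complex_is_Real_iff\<close>)
    ultimately show ?thesis by simp
  qed
  have "F constant_on ball 0 1"
  proof (rule ccontr)
    assume "\<not> F constant_on ball 0 1"
    then have "open (F ` ball 0 1)"
      by (intro open_mapping_thm[OF hol]) auto
    then obtain e where e: "e > 0" "ball (F 0) e \<subseteq> F ` ball 0 1"
      by (metis open_contains_ball image_eqI centre_in_ball zero_less_one)
    have "F 0 + \<i> * of_real (e / 2) \<in> ball (F 0) e"
      using e(1) by (simp add: dist_norm norm_mult)
    with e(2) obtain z where z: "z \<in> ball 0 1" "F z = F 0 + \<i> * of_real (e / 2)"
      by (metis imageE subsetD)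
    then show False using Im_0[of z] Im_0[of 0] e(1) by simp
  qed
  then obtain y where "F z = y" if "z \<in> ball 0 1" for z by (auto simp: constant_on_def)
  then have y: "F z = y" if "z \<in> cball 0 1" for z
    using continuous_constant_on_closure[of "ball 0 1" F y z] cont that by simp
  have "Im y = 0" using Im_0[of 0] y[of 0] by simp
  then have "F z = of_real (Re y)" if "z \<in> cball 0 1" for z
    using y[OF that] by (simp add: complex_eq_iff)
  then show thesis by (rule that)
qed

text \<open>
  The zero at the origin makes \<open>F \<zeta> / \<zeta>\<close> extend holomorphically, and the extension has real boundary
  values, so it is constant.
\<close>

lemma real_boundary_quotient:
  assumes cont: "continuous_on (cball 0 1) F" and hol: "F holomorphic_on ball 0 1"
    and "F 0 = 0"
    and real: "\<And>\<zeta>. \<zeta> \<in> sphere 0 1 \<Longrightarrow> F \<zeta> / \<zeta> \<in> \<real>"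
  obtains r :: real where "\<And>\<zeta>. \<zeta> \<in> cball 0 1 \<Longrightarrow> F \<zeta> = \<zeta> * of_real r"
proof -
  define H where "H z = (if z = 0 then deriv F 0 else F z / z)" for z
  have hol_H: "H holomorphic_on ball 0 1"
    using pole_lemma[OF hol, of 0] \<open>F 0 = 0\<close> by (simp add: H_def[abs_def] cong: if_cong)
  have "continuous_on (cball 0 1) H"
  proof -
    \<comment> \<open>Near the origin \<open>H\<close> is holomorphic, and away from it \<open>H\<close> is a quotient of continuous functions.\<close>
    have "continuous_on (cball 0 (1/2)) H"
      by (rule holomorphic_on_imp_continuous_on, rule holomorphic_on_subset[OF hol_H]) auto
    moreover have "continuous_on (cball 0 1 - ball 0 (1/2)) H"
    proof (rule continuous_on_eq)
      show "continuous_on (cball 0 1 - ball 0 (1/2)) (\<lambda>z. F z / z)"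
        by (intro continuous_intros continuous_on_subset[OF cont]) auto
    qed (auto simp: H_def)
    ultimately have "continuous_on (cball 0 (1/2) \<union> (cball 0 1 - ball 0 (1/2))) H"
      by (intro continuous_on_closed_Un) (auto intro: closed_Diff)
    moreover have "cball 0 (1/2) \<union> (cball 0 1 - ball 0 (1/2)) = cball (0::complex) 1"
      by auto
    ultimately show ?thesis by simp
  qed
  moreover have "H z \<in> \<real>" if "z \<in> sphere 0 1" for z
    using real[OF that] that by (auto simp: H_def)
  ultimately obtain r where r: "H z = of_real r" if "z \<in> cball 0 1" for z
    using real_boundary_values_imp_constant[OF _ hol_H] by metis
  have "F z = z * of_real r" if "z \<in> cball 0 1" for z
    using r[OF that] \<open>F 0 = 0\<close> by (cases "z = 0") (auto simp: H_def field_simps)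
  then show thesis by (rule that)
qed

lemma zero_boundary_values_imp_zero:
  assumes "continuous_on (cball 0 1) F" "F holomorphic_on ball 0 1"
    and zero: "\<And>\<zeta>. \<zeta> \<in> sphere 0 1 \<Longrightarrow> F \<zeta> = 0" and "z \<in> cball 0 1"
  shows "F z = 0"
proof -
  obtain r :: real where r: "F \<zeta> = of_real r" if "\<zeta> \<in> cball 0 1" for \<zeta>
    using real_boundary_values_imp_constant[OF assms(1,2)] zero by (metis Reals_0)
  with zero[of 1] r[of 1] show ?thesis using \<open>z \<in> cball 0 1\<close> by simp
qed

section \<open>The conormal fibers of a quadric\<close>

lemma z_part_join_zw [simp]: "z_part (join_zw z w) = z"
  by (simp add: z_part_def join_zw_def)

lemma join_zw_nth [simp]:
  "join_zw z w $ Inl k = z $ k" "join_zw z w $ Inr j = w $ j"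
  by (simp_all add: join_zw_def)

lemma vec_sum_type_eqI:
  fixes p q :: "complex ^ ('n::finite + 'd::finite)"
  assumes "\<And>k. p $ Inl k = q $ Inl k" "\<And>j. p $ Inr j = q $ Inr j"
  shows "p = q"
  unfolding vec_eq_iff using assms by (metis sum.exhaust)

lemma hermitian_matrix_cnj:
  assumes "hermitian_matrix A"
  shows "cnj (A $ i $ k) = A $ k $ i"
proof -
  have "cnj (A $ i $ k) = transpose (map_matrix cnj A) $ k $ i"
    by (simp add: transpose_def map_matrix_def)
  then show ?thesis using assms by (simp only: hermitian_matrix_def)
qed

text \<open>
  The two halves of the derivative of the Hermitian form, in \<open>z\<close> and in its conjugate, have the
  same real part, which gives the factor \<open>2\<close>.
\<close>

lemma has_derivative_quadric_rho:
  fixes A :: "'d::finite \<Rightarrow> complex ^ 'n::finite ^ 'n"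
  assumes "hermitian_matrix (A j)"
  shows "(quadric_rho A j has_derivative
           (\<lambda>h. Re (h $ Inr j) - 2 * Re (\<Sum>i\<in>UNIV. cnj ((A j *v z_part q) $ i) * h $ Inl i))) (at q)"
proof -
  have nth: "((\<lambda>q. q $ k) has_derivative (\<lambda>h. h $ k)) (at q)" for k :: "'n + 'd"
    by (rule bounded_linear_imp_has_derivative) (rule bounded_linear_vec_nth)
  note [derivative_intros] =
    nth bounded_linear.has_derivative[OF bounded_linear_Re] bounded_linear.has_derivative[OF bounded_linear_cnj]
  have "((\<lambda>q. Re (q $ Inr j) - Re (\<Sum>i\<in>UNIV. cnj (q $ Inl i) * (\<Sum>l\<in>UNIV. A j $ i $ l * q $ Inl l)))
      has_derivative
        (\<lambda>h. Re (h $ Inr j) - Re (\<Sum>i\<in>UNIV. cnj (q $ Inl i) * (\<Sum>l\<in>UNIV. A j $ i $ l * h $ Inl l)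
               + cnj (h $ Inl i) * (\<Sum>l\<in>UNIV. A j $ i $ l * q $ Inl l)))) (at q)"
    by (auto intro!: derivative_eq_intros simp: add_ac)
  moreover have "Re (\<Sum>i\<in>UNIV. cnj (q $ Inl i) * (\<Sum>l\<in>UNIV. A j $ i $ l * h $ Inl l)
               + cnj (h $ Inl i) * (\<Sum>l\<in>UNIV. A j $ i $ l * q $ Inl l))
        = 2 * Re (\<Sum>i\<in>UNIV. cnj ((A j *v z_part q) $ i) * h $ Inl i)" for h :: "complex ^ ('n + 'd)"
  proof -
    let ?s = "\<Sum>i\<in>UNIV. cnj ((A j *v z_part q) $ i) * h $ Inl i"
    have "(\<Sum>i\<in>UNIV. cnj (q $ Inl i) * (\<Sum>l\<in>UNIV. A j $ i $ l * h $ Inl l))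
        = (\<Sum>i\<in>UNIV. \<Sum>l\<in>UNIV. cnj (q $ Inl i) * A j $ i $ l * h $ Inl l)"
      by (simp add: sum_distrib_left mult.assoc)
    also have "\<dots> = (\<Sum>l\<in>UNIV. \<Sum>i\<in>UNIV. cnj (q $ Inl i) * A j $ i $ l * h $ Inl l)"
      by (rule sum.swap)
    also have "\<dots> = ?s"
      by (simp add: matrix_vector_mult_def z_part_def sum_distrib_left hermitian_matrix_cnj[OF assms] mult_ac)
    finally have 1: "(\<Sum>i\<in>UNIV. cnj (q $ Inl i) * (\<Sum>l\<in>UNIV. A j $ i $ l * h $ Inl l)) = ?s" .
    have 2: "(\<Sum>i\<in>UNIV. cnj (h $ Inl i) * (\<Sum>l\<in>UNIV. A j $ i $ l * q $ Inl l)) = cnj ?s"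
      by (simp add: matrix_vector_mult_def z_part_def mult.commute)
    show ?thesis by (simp only: sum.distrib 1 2) simp
  qed
  moreover have "quadric_rho A j = (\<lambda>q. Re (q $ Inr j)
      - Re (\<Sum>i\<in>UNIV. cnj (q $ Inl i) * (\<Sum>l\<in>UNIV. A j $ i $ l * q $ Inl l)))"
    by (simp add: fun_eq_iff quadric_rho_def herm_form_def z_part_def w_part_def matrix_vector_mult_def)
  ultimately show ?thesis by simp
qed

lemma del_quadric_rho:
  fixes A :: "'d::finite \<Rightarrow> complex ^ 'n::finite ^ 'n"
  assumes "hermitian_matrix (A j)"
  shows "del (quadric_rho A j) q = join_zw (\<chi> k. - cnj ((A j *v z_part q) $ k)) (axis j (1/2))"
proof -
  have D: "frechet_derivative (quadric_rho A j) (at q) =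
      (\<lambda>h. Re (h $ Inr j) - 2 * Re (\<Sum>i\<in>UNIV. cnj ((A j *v z_part q) $ i) * h $ Inl i))"
    using frechet_derivative_at[OF has_derivative_quadric_rho[where A = A and j = j, OF assms]] by simp
  have sum_axis: "(\<Sum>i\<in>UNIV. b i * axis (Inl k) t $ Inl i) = b k * t"
    for b :: "'n \<Rightarrow> complex" and k t
  proof -
    have "(\<Sum>i\<in>UNIV. b i * axis (Inl k) t $ Inl i) = (\<Sum>i\<in>UNIV. if i = k then b i * t else 0)"
      by (rule sum.cong) (auto simp: axis_def)
    then show ?thesis by simp
  qed
  show ?thesis
    by (rule vec_sum_type_eqI; unfold del_def D vec_lambda_beta join_zw_nth sum_axis)
      (auto simp: axis_def complex_eq_iff)
qed

text \<open>The \<open>w\<close>-part shows the coefficients: this is what makes them accessible to function theory.\<close>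

lemma conormal_combination:
  fixes A :: "'d::finite \<Rightarrow> complex ^ 'n::finite ^ 'n"
  assumes "\<And>j. hermitian_matrix (A j)"
  shows "(\<Sum>j\<in>UNIV. c j *\<^sub>R del (quadric_rho A j) q) =
    join_zw (\<chi> k. - cnj ((\<Sum>j\<in>UNIV. c j *\<^sub>R (A j *v z_part q)) $ k)) (\<chi> j. of_real (c j) / 2)"
proof (rule vec_sum_type_eqI)
  fix j
  have "(\<Sum>i\<in>UNIV. c i *\<^sub>R (axis i (1/2) $ j :: complex)) = (\<Sum>i\<in>UNIV. if i = j then of_real (c j) / 2 else 0)"
    by (rule sum.cong) (auto simp: axis_def scaleR_conv_of_real)
  then show "(\<Sum>j\<in>UNIV. c j *\<^sub>R del (quadric_rho A j) q) $ Inr j =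
      join_zw (\<chi> k. - cnj ((\<Sum>j\<in>UNIV. c j *\<^sub>R (A j *v z_part q)) $ k)) (\<chi> j. of_real (c j) / 2) $ Inr j"
    by (simp add: del_quadric_rho[where A = A, OF assms])
qed (simp add: del_quadric_rho[where A = A, OF assms] sum_negf)

section \<open>Defective discs\<close>

lemma combination_along_disc:
  fixes A :: "'d::finite \<Rightarrow> complex ^ 'n::finite ^ 'n"
  shows "(\<Sum>j\<in>UNIV. c j *\<^sub>R (A j *v (t *s V))) $ k = t * (\<Sum>j\<in>UNIV. c j *\<^sub>R (A j *v V)) $ k"
  by (simp add: vector_scalar_commute sum_distrib_left scaleR_conv_of_real mult.left_commute)

text \<open>
  Off the origin \<open>g \<zeta> = \<zeta> h \<zeta>\<close>; both sides are continuous at \<open>0\<close>, where the right one vanishes.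
\<close>

lemma holomorphic_quotient_imp_zero:
  assumes "holo_disc g" "holomorphic_vec_on h (ball 0 1)"
    and gh: "\<And>\<zeta>. \<zeta> \<in> ball 0 1 - {0} \<Longrightarrow> h \<zeta> = (1 / \<zeta>) *s g \<zeta>"
  shows "g 0 = 0"
proof -
  have "g 0 $ k = 0" for k
  proof -
    have "(\<lambda>z. g z $ k) holomorphic_on ball 0 1" "(\<lambda>z. h z $ k) holomorphic_on ball 0 1"
      using assms by (auto simp: holo_disc_def holomorphic_vec_on_def)
    then have "continuous_on (ball 0 1) (\<lambda>z. g z $ k - z * h z $ k)"
      by (intro continuous_intros holomorphic_on_imp_continuous_on)
    then have "((\<lambda>z. g z $ k - z * h z $ k) \<longlongrightarrow> g 0 $ k - 0 * h 0 $ k) (at 0)"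
      by (auto simp: continuous_on_eq_continuous_at isCont_def dest: bspec[of _ _ 0])
    moreover have "eventually (\<lambda>z. g z $ k - z * h z $ k = 0) (at 0)"
    proof -
      have "eventually (\<lambda>z::complex. z \<in> ball 0 1 - {0}) (at 0)"
        by (rule eventually_at_in_open) auto
      then show ?thesis by eventually_elim (simp add: gh)
    qed
    then have "((\<lambda>z. g z $ k - z * h z $ k) \<longlongrightarrow> 0) (at 0)"
      by (rule tendsto_eventually)
    ultimately show ?thesis using tendsto_unique[of "at (0::complex)"] by fastforce
  qed
  then show ?thesis by (simp add: vec_eq_iff)
qed

lemma defective_imp_relation:
  fixes A :: "'d::finite \<Rightarrow> complex ^ 'n::finite ^ 'n"
  assumes herm: "\<And>j. hermitian_matrix (A j)"
    and zf: "\<And>\<zeta>. \<zeta> \<in> sphere 0 1 \<Longrightarrow> z_part (f \<zeta>) = (1 - \<zeta>) *s V"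
    and lift: "stationary_lift (quadric_rho A) f g" and "g 0 = 0"
  shows "\<exists>c. (\<Sum>j\<in>UNIV. c j *\<^sub>R (A j *v V)) = 0 \<and> (\<exists>j. c j \<noteq> 0)"
proof -
  have cont: "continuous_on (cball 0 1) (\<lambda>z. g z $ k)" and hol: "(\<lambda>z. g z $ k) holomorphic_on ball 0 1" for k
    using lift by (auto simp: stationary_lift_def holo_disc_def holomorphic_vec_on_def intro!: continuous_intros)
  have "\<exists>c. g z = z *s (\<Sum>j\<in>UNIV. c j *\<^sub>R del (quadric_rho A j) (f z))" if "z \<in> sphere 0 1" for z
  proof -
    from lift that obtain p where "p \<in> conormal_fiber (quadric_rho A) (f z)" "g z = z *s p"
      unfolding stationary_lift_def by blast
    then show ?thesis unfolding conormal_fiber_def span_range_iff by blast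
  qed
  then obtain c where c: "g z = z *s (\<Sum>j\<in>UNIV. c z j *\<^sub>R del (quadric_rho A j) (f z))"
    if "z \<in> sphere 0 1" for z by metis
  have g_w: "g z $ Inr j = z * of_real (c z j / 2)" if "z \<in> sphere 0 1" for z j
    by (simp add: c[OF that] conormal_combination[where A = A, OF herm])
  have "\<exists>r. \<forall>z\<in>cball 0 1. g z $ Inr j = z * of_real r" for j
  proof -
    have "g z $ Inr j / z \<in> \<real>" if "z \<in> sphere 0 1" for z
    proof -
      have "z \<noteq> 0" using that by auto
      then have "g z $ Inr j / z = of_real (c z j / 2)" using g_w[OF that] by simp
      then show ?thesis by (metis Reals_of_real)
    qed
    then show ?thesis
      using real_boundary_quotient[OF cont hol, of "Inr j"] \<open>g 0 = 0\<close> by (metis zero_index)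
  qed
  then obtain r where r: "g z $ Inr j = z * of_real (r j)" if "z \<in> cball 0 1" for z j by metis
  \<comment> \<open>The \<open>w\<close>-part of a conormal covector is half its coefficient vector, whence the factor \<open>2\<close>.\<close>
  have c_const: "c z j = 2 * r j" if "z \<in> sphere 0 1" for z j
  proof -
    have "z * of_real (c z j / 2) = z * of_real (r j)"
      using g_w[OF that, of j] r[of z j] that by (metis sphere_cball subsetD)
    moreover have "z \<noteq> 0" using that by auto
    ultimately have "c z j / 2 = r j" by (metis mult_left_cancel of_real_eq_iff)
    then show ?thesis by simp
  qed
  define S where "S = (\<Sum>j\<in>UNIV. (2 * r j) *\<^sub>R (A j *v V))"
  have "S $ k = 0" for k
  proof -
    \<comment> \<open>On the circle \<open>z (1 - cnj z) = z - 1\<close>, so the boundary values are those of an affine function.\<close>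
    have "g z $ Inl k - (1 - z) * cnj (S $ k) = 0" if z: "z \<in> sphere 0 1" for z
    proof -
      have "z * cnj z = 1" using z by (simp add: complex_norm_square[symmetric])
      have "g z $ Inl k = - (z * (1 - cnj z)) * cnj (S $ k)"
        using c[OF z] zf[OF z]
        by (simp only: conormal_combination[where A = A, OF herm] combination_along_disc c_const[OF z] S_def) simp
      also have "z * (1 - cnj z) = z - 1" using \<open>z * cnj z = 1\<close> by (simp add: algebra_simps)
      finally show ?thesis by (simp add: algebra_simps)
    qed
    moreover have "continuous_on (cball 0 1) (\<lambda>z. g z $ Inl k - (1 - z) * cnj (S $ k))"
      by (intro continuous_on_diff cont continuous_intros)
    moreover have "(\<lambda>z. g z $ Inl k - (1 - z) * cnj (S $ k)) holomorphic_on ball 0 1"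
      by (intro holomorphic_on_diff hol holomorphic_intros)
    ultimately have "g 0 $ Inl k - (1 - 0) * cnj (S $ k) = 0"
      using zero_boundary_values_imp_zero[of "\<lambda>z. g z $ Inl k - (1 - z) * cnj (S $ k)" 0] by simp
    then show ?thesis using \<open>g 0 = 0\<close> by simp
  qed
  then have "S = 0" by (simp add: vec_eq_iff)
  moreover have "\<exists>j. 2 * r j \<noteq> 0"
  proof (rule ccontr)
    assume "\<not> ?thesis"
    then have "g 1 = 0" using c[of 1] c_const[of 1] by simp
    then show False using lift by (auto simp: stationary_lift_def dest: bspec[of _ _ 1])
  qed
  ultimately show ?thesis unfolding S_def by (intro exI[of _ "\<lambda>j. 2 * r j"] conjI)
qed

lemma relation_imp_defective:
  fixes A :: "'d::finite \<Rightarrow> complex ^ 'n::finite ^ 'n"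
  assumes herm: "\<And>j. hermitian_matrix (A j)"
    and zf: "\<And>\<zeta>. \<zeta> \<in> sphere 0 1 \<Longrightarrow> z_part (f \<zeta>) = (1 - \<zeta>) *s V"
    and stat: "stationary_disc (quadric_rho A) f"
    and rel: "(\<Sum>j\<in>UNIV. c j *\<^sub>R (A j *v V)) = 0" and c: "c i \<noteq> 0"
  shows "defective_disc (quadric_rho A) f"
proof -
  define p :: "complex ^ ('n + 'd)" where "p = join_zw 0 (\<chi> j. of_real (c j) / 2)"
  have "p $ Inr i \<noteq> 0" using c by (simp add: p_def)
  then have "p \<noteq> 0" by auto
  have p: "p \<in> conormal_fiber (quadric_rho A) (f z)" if "z \<in> sphere 0 1" for z
  proof -
    have "p = (\<Sum>j\<in>UNIV. c j *\<^sub>R del (quadric_rho A j) (f z))"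
      unfolding conormal_combination[where A = A, OF herm] zf[OF that] combination_along_disc rel
      by (simp add: p_def vec_sum_type_eqI)
    then show ?thesis unfolding conormal_fiber_def span_range_iff by blast
  qed
  have "continuous_on (cball 0 1) (\<lambda>z. z *s p)"
    unfolding vector_scalar_mult_def by (intro continuous_intros)
  moreover have "holomorphic_vec_on (\<lambda>z. z *s p) (ball 0 1)"
    by (auto simp: holomorphic_vec_on_def intro!: holomorphic_intros)
  ultimately have "stationary_lift (quadric_rho A) f (\<lambda>z. z *s p)"
    using p \<open>p \<noteq> 0\<close> by (auto simp: stationary_lift_def holo_disc_def)
  moreover have "holomorphic_vec_on (\<lambda>_. p) (ball 0 1)"
    by (simp add: holomorphic_vec_on_def)
  moreover have "\<forall>z\<in>ball 0 1 - {0}. p = (1 / z) *s (z *s p)"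
    by (simp add: vector_smult_assoc)
  ultimately show ?thesis
    unfolding defective_disc_def using stat by fast
qed

theorem lemma2p3:
  fixes A :: "'d::finite \<Rightarrow> complex ^ 'n::finite ^ 'n"
    and V :: "complex ^ 'n"
    and f :: "complex \<Rightarrow> complex ^ ('n + 'd)"
  assumes "\<And>j. hermitian_matrix (A j)"
    and "\<And>\<zeta>. \<zeta> \<in> cball 0 1 \<Longrightarrow>
           f \<zeta> = join_zw ((1 - \<zeta>) *s V) (\<chi> j. 2 * (1 - \<zeta>) * herm_form (A j) V)"
    and "stationary_disc (quadric_rho A) f"
  shows "nondefective_disc (quadric_rho A) f \<longleftrightarrow>
         inj (\<lambda>j. A j *v V) \<and> independent (range (\<lambda>j. A j *v V))"
proof -
  have zf: "z_part (f \<zeta>) = (1 - \<zeta>) *s V" if "\<zeta> \<in> sphere 0 1" for \<zeta>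
    using assms(2)[of \<zeta>] that by simp
  have "defective_disc (quadric_rho A) f \<longleftrightarrow>
      (\<exists>c. (\<Sum>j\<in>UNIV. c j *\<^sub>R (A j *v V)) = 0 \<and> (\<exists>j. c j \<noteq> 0))"
  proof
    assume "defective_disc (quadric_rho A) f"
    then obtain g h where lift: "stationary_lift (quadric_rho A) f g"
      and h: "holomorphic_vec_on h (ball 0 1)" "\<forall>\<zeta>\<in>ball 0 1 - {0}. h \<zeta> = (1 / \<zeta>) *s g \<zeta>"
      unfolding defective_disc_def by blast
    have "g 0 = 0"
      using holomorphic_quotient_imp_zero[of g h] lift h by (auto simp: stationary_lift_def)
    show "\<exists>c. (\<Sum>j\<in>UNIV. c j *\<^sub>R (A j *v V)) = 0 \<and> (\<exists>j. c j \<noteq> 0)"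
      by (intro defective_imp_relation[where A = A, OF assms(1)]) fact+
  next
    assume "\<exists>c. (\<Sum>j\<in>UNIV. c j *\<^sub>R (A j *v V)) = 0 \<and> (\<exists>j. c j \<noteq> 0)"
    then obtain c i where "(\<Sum>j\<in>UNIV. c j *\<^sub>R (A j *v V)) = 0" "c i \<noteq> 0" by auto
    show "defective_disc (quadric_rho A) f"
      by (intro relation_imp_defective[where A = A, OF assms(1)]) fact+
  qed
  then show ?thesis
    by (simp add: independent_family_iff nondefective_disc_def assms(3))
qed

end
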